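(* Let $m,n$ be fixed nonzero integers with $m+n\neq0$. Let $\mathcal{N}$ be a non-trivial nest on a separable complex Hilbert space $H$ and $\mathrm{alg}\mathcal{N}$ the associated nest algebra. If $P\in\mathcal{N}$ is a non-trivial idempotent (i.e. $P\neq0,I$) and $\delta:\mathrm{alg}\mathcal{N}\to\mathrm{alg}\mathcal{N}$ is an $(m,n)$-derivable mapping at $P$, then $\delta$ is a derivation.
   Context: A nest on $H$ is a totally ordered collection of closed subspaces of $H$ containing $(0)$ and $H$ and closed under arbitrary intersections and closed linear spans; it is non-trivial if it is not $\{(0),H\}$. Closed subspaces are identified with the orthogonal projections onto them. $\mathrm{alg}\mathcal{N}$ is the algebra of all bounded linear operators on $H$ leaving every member of $\mathcal{N}$ invariant. For a unital algebra $\mathcal{A}$ and $Z\in\mathcal{A}$, a linear map $\delta:\mathcal{A}\to\mathcal{A}$ is $(m,n)$-derivable at $Z$ if $m\delta(AB)+n\delta(BA)=m\delta(A)B+mA\delta(B)+n\delta(B)A+nB\delta(A)$ for all $A,B\in\mathcal{A}$ with $AB=Z$. It is a derivation if $\delta(AB)=\delta(A)B+A\delta(B)$ for all $A,B\in\mathcal{A}$. No continuity of $\delta$ is assumed. *)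

theory Defs
  imports "HOL-Analysis.Analysis"
begin

section \<open>Complex Hilbert spaces\<close>

class complex_vector = real_vector +
  fixes scaleC :: "complex \<Rightarrow> 'a \<Rightarrow> 'a" (infixr "*\<^sub>C" 75)
  assumes scaleC_add_right: "a *\<^sub>C (x + y) = a *\<^sub>C x + a *\<^sub>C y"
    and scaleC_add_left: "(a + b) *\<^sub>C x = a *\<^sub>C x + b *\<^sub>C x"
    and scaleC_scaleC: "a *\<^sub>C b *\<^sub>C x = (a * b) *\<^sub>C x"
    and scaleC_one: "1 *\<^sub>C x = x"
    and scaleR_scaleC: "r *\<^sub>R x = complex_of_real r *\<^sub>C x"

global_interpretation complex_vector: vector_space "scaleC :: complex \<Rightarrow> 'a \<Rightarrow> 'a::complex_vector"
  defines csubspace = complex_vector.subspace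
    and cspan = complex_vector.span
  by unfold_locales (simp_all add: scaleC_add_right scaleC_add_left scaleC_scaleC scaleC_one)

text \<open>
  The inner product is linear in its first argument. The last axiom carries positive
  definiteness, since \<^term>\<open>norm\<close> is already a norm on the underlying real space.
\<close>

class complex_inner = complex_vector + real_normed_vector +
  fixes cinner :: "'a \<Rightarrow> 'a \<Rightarrow> complex"
  assumes cinner_commute: "cinner x y = cnj (cinner y x)"
    and cinner_add_left: "cinner (x + y) z = cinner x z + cinner y z"
    and cinner_scaleC_left: "cinner (a *\<^sub>C x) y = a * cinner x y"
    and cinner_self: "cinner x x = complex_of_real ((norm x)\<^sup>2)"

class chilbert_space = complex_inner + complete_space

lemma norm_scaleC: "norm (a *\<^sub>C x) = cmod a * norm x" for x :: "'a::complex_inner"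
proof -
  have "cinner (a *\<^sub>C x) (a *\<^sub>C x) = a * cnj a * cinner x x"
    by (metis cinner_commute cinner_scaleC_left complex_cnj_mult mult.assoc mult.left_commute)
  also have "\<dots> = complex_of_real ((cmod a * norm x)\<^sup>2)"
    by (simp only: cinner_self complex_norm_square[symmetric] power_mult_distrib of_real_mult of_real_power)
  finally have "(norm (a *\<^sub>C x))\<^sup>2 = (cmod a * norm x)\<^sup>2"
    unfolding cinner_self of_real_eq_iff .
  then show ?thesis
    by (simp add: power2_eq_iff_nonneg)
qed

lemma bounded_linear_scaleC: "bounded_linear (\<lambda>x::'a::complex_inner. a *\<^sub>C x)"
  by (rule bounded_linear_intro[where K = "cmod a"])
    (simp_all add: scaleC_add_right scaleR_scaleC scaleC_scaleC norm_scaleC mult.commute)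

instantiation complex :: chilbert_space
begin

definition "scaleC (a::complex) (x::complex) = a * x"
definition "cinner (x::complex) (y::complex) = x * cnj y"

instance
  by standard
    (simp_all add: scaleC_complex_def cinner_complex_def algebra_simps scaleR_conv_of_real
      complex_norm_square del: of_real_power)

end


section \<open>Bounded complex-linear operators\<close>

text \<open>
  The type \<^typ>\<open>'h \<Rightarrow>\<^sub>L 'h\<close> consists of the bounded \<^emph>\<open>real\<close>-linear operators;
  the bounded operators of the complex Hilbert space are those satisfying \<open>clinear_op\<close>.
\<close>

instantiation blinfun :: (real_normed_vector, complex_inner) complex_vector
begin

lift_definition scaleC_blinfun :: "complex \<Rightarrow> ('a \<Rightarrow>\<^sub>L 'b) \<Rightarrow> ('a \<Rightarrow>\<^sub>L 'b)"
  is "\<lambda>a f x. a *\<^sub>C f x"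
  by (rule bounded_linear_compose[OF bounded_linear_scaleC])

instance
  by standard
    (transfer; simp add: fun_eq_iff scaleC_add_right scaleC_add_left scaleC_scaleC scaleC_one
      scaleR_scaleC)+

end

definition clinear_op :: "('h::complex_inner \<Rightarrow>\<^sub>L 'h) \<Rightarrow> bool" where
  "clinear_op A \<longleftrightarrow> (\<forall>c x. blinfun_apply A (c *\<^sub>C x) = c *\<^sub>C blinfun_apply A x)"

definition orthogonal_projection_onto :: "('h::complex_inner \<Rightarrow>\<^sub>L 'h) \<Rightarrow> 'h set \<Rightarrow> bool" where
  "orthogonal_projection_onto P S \<longleftrightarrow>
    clinear_op P \<and> (\<forall>x. blinfun_apply P x \<in> S \<and> (\<forall>y\<in>S. cinner (x - blinfun_apply P x) y = 0))"


section \<open>Nests and nest algebras\<close>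

text \<open>
  The families \<open>F\<close> below may be empty; this only yields \<open>\<Inter>{} = UNIV\<close> and the span \<open>{0}\<close>.
\<close>

definition nest :: "'h::chilbert_space set set \<Rightarrow> bool" where
  "nest N \<longleftrightarrow>
    (\<forall>S\<in>N. csubspace S \<and> closed S) \<and>
    (\<forall>S\<in>N. \<forall>T\<in>N. S \<subseteq> T \<or> T \<subseteq> S) \<and>
    {0} \<in> N \<and> UNIV \<in> N \<and>
    (\<forall>F\<subseteq>N. \<Inter>F \<in> N) \<and>
    (\<forall>F\<subseteq>N. closure (cspan (\<Union>F)) \<in> N)"

definition nontrivial_nest :: "'h::chilbert_space set set \<Rightarrow> bool" where
  "nontrivial_nest N \<longleftrightarrow> nest N \<and> N \<noteq> {{0}, UNIV}"

definition nest_algebra :: "'h::chilbert_space set set \<Rightarrow> ('h \<Rightarrow>\<^sub>L 'h) set" where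
  "nest_algebra N = {A. clinear_op A \<and> (\<forall>S\<in>N. blinfun_apply A ` S \<subseteq> S)}"

text \<open>The members of the nest, read as orthogonal projections.\<close>

definition nest_projections :: "'h::chilbert_space set set \<Rightarrow> ('h \<Rightarrow>\<^sub>L 'h) set" where
  "nest_projections N = {P. \<exists>S\<in>N. orthogonal_projection_onto P S}"


section \<open>Derivable maps on operator algebras\<close>

text \<open>
  Maps \<open>\<A> \<rightarrow> \<A>\<close> are total functions on the operator type of which only the values on \<open>\<A>\<close> matter.
\<close>

definition linear_map_on :: "('h::complex_inner \<Rightarrow>\<^sub>L 'h) set \<Rightarrow> (('h \<Rightarrow>\<^sub>L 'h) \<Rightarrow> ('h \<Rightarrow>\<^sub>L 'h)) \<Rightarrow> bool" where
  "linear_map_on \<A> \<delta> \<longleftrightarrow>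
    (\<forall>A\<in>\<A>. \<delta> A \<in> \<A>) \<and>
    (\<forall>A\<in>\<A>. \<forall>B\<in>\<A>. \<delta> (A + B) = \<delta> A + \<delta> B) \<and>
    (\<forall>c. \<forall>A\<in>\<A>. \<delta> (c *\<^sub>C A) = c *\<^sub>C \<delta> A)"

definition derivable_at ::
  "('h::complex_inner \<Rightarrow>\<^sub>L 'h) set \<Rightarrow> int \<Rightarrow> int \<Rightarrow> ('h \<Rightarrow>\<^sub>L 'h) \<Rightarrow> (('h \<Rightarrow>\<^sub>L 'h) \<Rightarrow> ('h \<Rightarrow>\<^sub>L 'h)) \<Rightarrow> bool" where
  "derivable_at \<A> m n Z \<delta> \<longleftrightarrow>
    linear_map_on \<A> \<delta> \<and>
    (\<forall>A\<in>\<A>. \<forall>B\<in>\<A>. A o\<^sub>L B = Z \<longrightarrow>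
      of_int m *\<^sub>R \<delta> (A o\<^sub>L B) + of_int n *\<^sub>R \<delta> (B o\<^sub>L A) =
        of_int m *\<^sub>R (\<delta> A o\<^sub>L B) + of_int m *\<^sub>R (A o\<^sub>L \<delta> B)
        + of_int n *\<^sub>R (\<delta> B o\<^sub>L A) + of_int n *\<^sub>R (B o\<^sub>L \<delta> A))"

definition derivation_on :: "('h::complex_inner \<Rightarrow>\<^sub>L 'h) set \<Rightarrow> (('h \<Rightarrow>\<^sub>L 'h) \<Rightarrow> ('h \<Rightarrow>\<^sub>L 'h)) \<Rightarrow> bool" where
  "derivation_on \<A> \<delta> \<longleftrightarrow>
    linear_map_on \<A> \<delta> \<and>
    (\<forall>A\<in>\<A>. \<forall>B\<in>\<A>. \<delta> (A o\<^sub>L B) = (\<delta> A o\<^sub>L B) + (A o\<^sub>L \<delta> B))"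

end

theory Submission
  imports Defs
begin

text \<open>
  Write \<open>e = P\<close>, \<open>f = I - P\<close>. Since \<open>f A e = 0\<close> on the nest algebra \<open>\<A>\<close>, it is triangular with
  corners \<open>e \<A> e\<close>, \<open>e \<A> f\<close>, \<open>f \<A> f\<close>; moreover \<open>e \<A> f\<close> contains all operators \<open>e T f\<close>, in
  particular enough rank-one operators to be a faithful bimodule, and every element of \<open>e \<A> e\<close> is
  an invertible one plus a multiple of \<open>e\<close> (Neumann series).

  Let \<open>D(A, B) = \<delta>(AB) - \<delta>(A)B - A\<delta>(B)\<close>. The hypothesis says \<open>m D(A, B) + n D(B, A) = 0\<close> whenever
  \<open>AB = e\<close>. After subtracting an inner derivation, \<open>\<delta> e = 0\<close>. Testing the pairs \<open>(e, e + X)\<close>,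
  \<open>(a, a\<inverse> + f)\<close> and \<open>(e + M, I - M)\<close> shows that \<open>\<delta>\<close> preserves the three corners; the pairs
  \<open>(a\<inverse> + M, a)\<close> and \<open>(e + M, e - MX + X)\<close> then give \<open>D(a, M) = 0\<close> and \<open>D(M, X) = 0\<close>. As \<open>D\<close> is a
  Hochschild 2-coboundary, \<open>D(a, b) M = 0\<close> and \<open>M D(X, Y) = 0\<close>, so faithfulness makes the diagonal
  parts of \<open>D\<close> vanish as well.
\<close>

section \<open>Derivable maps on triangular algebras\<close>

text \<open>The product is a parameter because the intended carrier is a set of operators under
  composition. Associativity and the unit laws are stated on the whole type, where composition
  satisfies them. \<open>unit_plus_scalar\<close> is the algebraic trace of the Neumann series: all
  that the argument takes from analysis about the first diagonal corner.\<close>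

locale triangular_algebra =
  fixes A :: "'a::real_vector set"
    and mul :: "'a \<Rightarrow> 'a \<Rightarrow> 'a" (infixl "\<odot>" 70)
    and e f :: 'a
  assumes subspace_A: "subspace A"
    and bilinear_mul: "bilinear (\<odot>)"
    and mul_closed: "\<lbrakk>x \<in> A; y \<in> A\<rbrakk> \<Longrightarrow> x \<odot> y \<in> A"
    and assoc: "x \<odot> y \<odot> z = x \<odot> (y \<odot> z)"
    and e_in: "e \<in> A" and f_in: "f \<in> A"
    and unit_left: "(e + f) \<odot> x = x" and unit_right: "x \<odot> (e + f) = x"
    and ee: "e \<odot> e = e" and ff: "f \<odot> f = f" and ef: "e \<odot> f = 0" and fe: "f \<odot> e = 0"
    and lower_zero: "x \<in> A \<Longrightarrow> f \<odot> x \<odot> e = 0"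
    and faithful_left: "\<lbrakk>a \<in> A; a \<odot> e = a; \<And>x. x \<in> A \<Longrightarrow> a \<odot> (e \<odot> x \<odot> f) = 0\<rbrakk> \<Longrightarrow> a = 0"
    and faithful_right: "\<lbrakk>b \<in> A; f \<odot> b = b; \<And>x. x \<in> A \<Longrightarrow> e \<odot> x \<odot> f \<odot> b = 0\<rbrakk> \<Longrightarrow> b = 0"
    and unit_plus_scalar: "\<lbrakk>a \<in> A; e \<odot> a \<odot> e = a\<rbrakk> \<Longrightarrow>
      \<exists>r. \<exists>b\<in>A. \<exists>c\<in>A. e \<odot> b \<odot> e = b \<and> e \<odot> c \<odot> e = c \<and> b \<odot> c = e \<and> c \<odot> b = e \<and> a = b + r *\<^sub>R e"
begin

lemmas mul_simps = bilinear_ladd[OF bilinear_mul] bilinear_radd[OF bilinear_mul]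
  bilinear_lsub[OF bilinear_mul] bilinear_rsub[OF bilinear_mul]
  bilinear_lneg[OF bilinear_mul] bilinear_rneg[OF bilinear_mul]
  bilinear_lmul[OF bilinear_mul] bilinear_rmul[OF bilinear_mul]
  bilinear_lzero[OF bilinear_mul] bilinear_rzero[OF bilinear_mul]

lemmas A_closed = subspace_add[OF subspace_A] subspace_diff[OF subspace_A] subspace_neg[OF subspace_A]
  subspace_scale[OF subspace_A] subspace_0[OF subspace_A] mul_closed e_in f_in

section \<open>Peirce corners and their multiplication rules\<close>

definition corner :: "'a \<Rightarrow> 'a \<Rightarrow> 'a set"
  where "corner p q = {x \<in> A. p \<odot> x = x \<and> x \<odot> q = x}"

lemma cornerD:
  assumes "x \<in> corner p q"
  shows "x \<in> A" "p \<odot> x = x" "x \<odot> q = x"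
  using assms by (auto simp: corner_def)

lemma subspace_corner: "subspace (corner p q)"
  by (rule subspaceI) (auto simp: corner_def mul_simps A_closed)

lemmas corner_closed = subspace_add[OF subspace_corner] subspace_diff[OF subspace_corner]
  subspace_neg[OF subspace_corner] subspace_scale[OF subspace_corner]

lemma corner_mul:
  assumes "x \<in> corner p q" "y \<in> corner q' r"
  shows "x \<odot> y \<in> corner p r"
  using assms by (simp add: corner_def mul_closed assoc) (metis assoc)

lemma corner_mul_zero:
  assumes "x \<in> corner p q" "y \<in> corner q' r" "q \<odot> q' = 0"
  shows "x \<odot> y = 0"
proof -
  have "x \<odot> y = (x \<odot> q) \<odot> (q' \<odot> y)"
    using assms by (simp add: corner_def)
  also have "\<dots> = x \<odot> ((q \<odot> q') \<odot> y)"
    by (simp add: assoc)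
  finally show ?thesis
    using assms by (simp add: mul_simps)
qed

lemma e_corner: "e \<in> corner e e" and f_corner: "f \<in> corner f f"
  by (auto simp: corner_def A_closed ee ff)

lemma e_mul_corner_f:
  assumes "x \<in> corner f q" shows "e \<odot> x = 0"
  using corner_mul_zero[OF e_corner assms ef] .

lemma f_mul_corner_e:
  assumes "x \<in> corner e q" shows "f \<odot> x = 0"
  using corner_mul_zero[OF f_corner assms fe] .

lemma corner_f_mul_e:
  assumes "x \<in> corner p f" shows "x \<odot> e = 0"
  using corner_mul_zero[OF assms e_corner fe] .

lemma corner_e_mul_f:
  assumes "x \<in> corner p e" shows "x \<odot> f = 0"
  using corner_mul_zero[OF assms f_corner ef] .

text \<open>As \<open>f \<odot> x \<odot> e = 0\<close>, an element has only three Peirce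
  components. One vanishing one-sided product removes two of them: \<open>e \<odot> x = 0\<close>
  the first row, \<open>x \<odot> f = 0\<close> the last column.\<close>

lemma corner_ffI: "\<lbrakk>x \<in> A; e \<odot> x = 0\<rbrakk> \<Longrightarrow> x \<in> corner f f"
  and corner_eeI: "\<lbrakk>x \<in> A; x \<odot> f = 0\<rbrakk> \<Longrightarrow> x \<in> corner e e"
  and corner_efI: "\<lbrakk>x \<in> A; x \<odot> e = 0; f \<odot> x = 0\<rbrakk> \<Longrightarrow> x \<in> corner e f"
proof -
  show "x \<in> corner f f" if "x \<in> A" "e \<odot> x = 0"
  proof -
    have l: "f \<odot> x = x"
      using unit_left[of x] that by (simp add: mul_simps)
    moreover have "x \<odot> e = 0"
      using lower_zero[OF that(1)] l by simp
    then have "x \<odot> f = x"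
      using unit_right[of x] by (simp add: mul_simps)
    ultimately show ?thesis
      using that by (simp add: corner_def)
  qed
  show "x \<in> corner e e" if "x \<in> A" "x \<odot> f = 0"
  proof -
    have l: "x \<odot> e = x"
      using unit_right[of x] that by (simp add: mul_simps)
    moreover have "f \<odot> x = 0"
      using lower_zero[OF that(1)] l by (simp add: assoc)
    then have "e \<odot> x = x"
      using unit_left[of x] by (simp add: mul_simps)
    ultimately show ?thesis
      using that by (simp add: corner_def)
  qed
  show "x \<in> corner e f" if "x \<in> A" "x \<odot> e = 0" "f \<odot> x = 0"
    using unit_left[of x] unit_right[of x] that by (simp add: mul_simps corner_def)
qed

lemma peirce_decomposition:
  assumes "x \<in> A"
  obtains a y b where "a \<in> corner e e" "y \<in> corner e f" "b \<in> corner f f" "x = a + y + b"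
proof
  show "e \<odot> x \<odot> e \<in> corner e e" "e \<odot> x \<odot> f \<in> corner e f" "f \<odot> x \<odot> f \<in> corner f f"
    using assms by (simp_all add: corner_def A_closed assoc ee ff)
       (metis assoc ee ff)+
  have "x = (e + f) \<odot> x \<odot> (e + f)"
    by (simp only: unit_left unit_right)
  then show "x = e \<odot> x \<odot> e + e \<odot> x \<odot> f + f \<odot> x \<odot> f"
    using lower_zero[OF assms] by (simp add: mul_simps add.assoc)
qed

lemma corner_ee_faithful:
  assumes "a \<in> corner e e" "\<And>x. x \<in> corner e f \<Longrightarrow> a \<odot> x = 0"
  shows "a = 0"
proof (rule faithful_left)
  show "a \<odot> (e \<odot> x \<odot> f) = 0" if "x \<in> A" for x
    by (rule assms(2)) (simp add: corner_def A_closed that, metis assoc ee ff)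
qed (use assms in \<open>auto simp: corner_def\<close>)

lemma corner_ff_faithful:
  assumes "b \<in> corner f f" "\<And>x. x \<in> corner e f \<Longrightarrow> x \<odot> b = 0"
  shows "b = 0"
proof (rule faithful_right)
  show "e \<odot> x \<odot> f \<odot> b = 0" if "x \<in> A" for x
    by (rule assms(2)) (simp add: corner_def A_closed that, metis assoc ee ff)
qed (use assms in \<open>auto simp: corner_def\<close>)

section \<open>Invertibility in the corner at \<open>e\<close>, whose unit is \<open>e\<close> and
  not \<open>e + f\<close>\<close>

definition inverse_pair :: "'a \<Rightarrow> 'a \<Rightarrow> bool"
  where "inverse_pair b c \<longleftrightarrow> b \<in> corner e e \<and> c \<in> corner e e \<and> b \<odot> c = e \<and> c \<odot> b = e"

lemma inverse_pairD:
  assumes "inverse_pair b c"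
  shows "b \<in> corner e e" "c \<in> corner e e" "b \<odot> c = e" "c \<odot> b = e"
  using assms by (simp_all add: inverse_pair_def)

text \<open>Reduces linear properties of the corner to its invertible elements: each element is such
  a one plus a multiple of \<open>e\<close>, and \<open>e\<close> is itself invertible there, which
  provides \<open>Q e\<close> in the case \<open>plus\<close>.\<close>

lemma unit_induct [consumes 1, case_names unit plus]:
  assumes "a \<in> corner e e"
    and unit: "\<And>b c. inverse_pair b c \<Longrightarrow> Q b"
    and plus: "\<And>b r. \<lbrakk>b \<in> corner e e; Q b; Q e\<rbrakk> \<Longrightarrow> Q (b + r *\<^sub>R e)"
  shows "Q a"
proof -
  have "inverse_pair e e"
    by (simp add: inverse_pair_def e_corner ee)
  then have e: "Q e" by (rule unit)
  have "e \<odot> a \<odot> e = a"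
    using assms(1) by (simp add: corner_def)
  then obtain r b c where bc: "b \<in> A" "c \<in> A" "e \<odot> b \<odot> e = b" "e \<odot> c \<odot> e = c"
    "b \<odot> c = e" "c \<odot> b = e" "a = b + r *\<^sub>R e"
    using unit_plus_scalar[of a] assms(1) by (auto simp: corner_def)
  then have "b \<in> corner e e" "c \<in> corner e e"
    by (simp_all add: corner_def) (metis assoc ee)+
  with bc have "inverse_pair b c"
    by (simp add: inverse_pair_def)
  then show ?thesis
    unfolding bc(7) by (intro plus e unit \<open>b \<in> corner e e\<close>)
qed

end

text \<open>The integers of the theorem enter only as real scalars. The identity is moved to one
  side so that it becomes a linear relation between two deviations from the Leibniz rule.\<close>

locale derivable_map = triangular_algebra +
  fixes \<delta> :: "'a \<Rightarrow> 'a" and m n :: real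
  assumes closed: "x \<in> A \<Longrightarrow> \<delta> x \<in> A"
    and add: "\<lbrakk>x \<in> A; y \<in> A\<rbrakk> \<Longrightarrow> \<delta> (x + y) = \<delta> x + \<delta> y"
    and scale: "x \<in> A \<Longrightarrow> \<delta> (r *\<^sub>R x) = r *\<^sub>R \<delta> x"
    and m: "m \<noteq> 0" and n: "n \<noteq> 0" and mn: "m + n \<noteq> 0"
    and derivable: "\<lbrakk>x \<in> A; y \<in> A; x \<odot> y = e\<rbrakk> \<Longrightarrow>
      m *\<^sub>R (\<delta> (x \<odot> y) - (\<delta> x \<odot> y + x \<odot> \<delta> y)) + n *\<^sub>R (\<delta> (y \<odot> x) - (\<delta> y \<odot> x + y \<odot> \<delta> x)) = 0"
begin

lemma minus: "x \<in> A \<Longrightarrow> \<delta> (- x) = - \<delta> x"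
  using scale[of x "-1"] by simp

lemma diff: "\<lbrakk>x \<in> A; y \<in> A\<rbrakk> \<Longrightarrow> \<delta> (x - y) = \<delta> x - \<delta> y"
  using add[of x "- y"] minus[of y] by (simp add: A_closed)

text \<open>The pair \<open>(e, e)\<close> and \<open>m + n \<noteq> 0\<close> give the Leibniz rule
  at \<open>e\<close>. Compressing it by \<open>e\<close> on both sides removes the first diagonal
  component; multiplying by \<open>f\<close> on the left and using \<open>lower_zero\<close> removes
  the bottom row.\<close>

lemma map_e_corner: "\<delta> e \<in> corner e f"
proof -
  have "(m + n) *\<^sub>R (\<delta> e - (\<delta> e \<odot> e + e \<odot> \<delta> e)) = 0"
    using derivable[of e e] by (simp add: ee e_in scaleR_add_left)
  then have *: "\<delta> e = \<delta> e \<odot> e + e \<odot> \<delta> e"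
    using mn by simp
  have "\<delta> e \<odot> e = \<delta> e \<odot> e + e \<odot> \<delta> e \<odot> e"
    by (subst *) (simp add: mul_simps assoc ee)
  then have 1: "e \<odot> \<delta> e \<odot> e = 0" by simp
  have "f \<odot> \<delta> e = f \<odot> \<delta> e \<odot> e"
    by (subst *) (simp add: mul_simps fe flip: assoc)
  then have 2: "f \<odot> \<delta> e = 0"
    using lower_zero[OF closed[OF e_in]] by simp
  have "\<delta> e \<odot> e = (e + f) \<odot> (\<delta> e \<odot> e)" by (simp only: unit_left)
  then have "\<delta> e \<odot> e = 0"
    using 1 lower_zero[OF closed[OF e_in]] by (simp add: mul_simps assoc)
  with 2 show ?thesis
    by (intro corner_efI closed e_in)
qed

end

section \<open>Normalised maps preserve the Peirce corners\<close>

locale normalised_derivable_map = derivable_map +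
  assumes map_e: "\<delta> e = 0"
begin

text \<open>Both products of \<open>e\<close> and \<open>e + X\<close> are \<open>e\<close>, so the
  hypothesis reduces to \<open>m e y + n y e = 0\<close> with \<open>y = \<delta> X\<close>. Since
  \<open>e y e = y e\<close>, multiplying by \<open>e\<close> on the right leaves
  \<open>(m + n) y e = 0\<close>, and then \<open>e y = 0\<close> as well.\<close>

lemma map_ff:
  assumes X: "X \<in> corner f f"
  shows "\<delta> X \<in> corner f f"
proof -
  let ?y = "\<delta> X"
  note [simp] = cornerD[OF X] e_mul_corner_f[OF X] corner_f_mul_e[OF X]
  have yA: "?y \<in> A" by (simp add: closed)
  have "m *\<^sub>R (- (e \<odot> ?y)) + n *\<^sub>R (- (?y \<odot> e)) = 0"
    using derivable[of e "e + X"] by (simp add: mul_simps ee add map_e A_closed)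
  then have "- (m *\<^sub>R (e \<odot> ?y)) = n *\<^sub>R (?y \<odot> e)"
    by simp
  then have *: "m *\<^sub>R (e \<odot> ?y) = - n *\<^sub>R (?y \<odot> e)"
    by (metis minus_minus scaleR_minus_left)
  have "?y \<odot> e = (e + f) \<odot> (?y \<odot> e)" by (simp only: unit_left)
  then have v: "e \<odot> ?y \<odot> e = ?y \<odot> e"
    using lower_zero[OF yA] by (simp add: mul_simps assoc)
  have "m *\<^sub>R (e \<odot> ?y) \<odot> e = - n *\<^sub>R (?y \<odot> e) \<odot> e"
    by (simp only: *)
  then have "(m + n) *\<^sub>R (?y \<odot> e) = 0"
    by (simp add: mul_simps v scaleR_add_left) (simp add: assoc ee)
  then have "?y \<odot> e = 0" using mn by simp
  with * m have "e \<odot> ?y = 0" by simp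
  then show ?thesis by (rule corner_ffI[OF yA])
qed

text \<open>Adding \<open>f\<close> to the inverse changes neither product, so the pairs
  \<open>(a, a')\<close> and \<open>(a, a' + f)\<close> are both admissible. Their difference is
  \<open>m y f + n f y = 0\<close> with \<open>y = \<delta> a\<close>; the terms with
  \<open>\<delta> f\<close> vanish by \<open>map_ff\<close>. Multiplying by \<open>f\<close> on the
  left gives \<open>(m + n) f y = 0\<close>.\<close>

lemma map_ee_unit:
  assumes "inverse_pair a a'"
  shows "\<delta> a \<in> corner e e"
proof -
  note ip = inverse_pairD[OF assms]
  note a = ip(1) and a' = ip(2)
  note [simp] = cornerD[OF a] cornerD[OF a'] ip(3,4)
  have q: "\<delta> f \<in> corner f f" by (rule map_ff[OF f_corner])
  have zero: "a \<odot> \<delta> f = 0" "\<delta> f \<odot> a = 0" "a \<odot> f = 0" "f \<odot> a = 0"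
    using corner_mul_zero[OF a q ef] corner_mul_zero[OF q a fe] corner_e_mul_f[OF a] f_mul_corner_e[OF a] by auto
  let ?y = "\<delta> a"
  have yA: "?y \<in> A" by (simp add: closed)
  have 1: "m *\<^sub>R (- (?y \<odot> a' + a \<odot> \<delta> a')) + n *\<^sub>R (- (\<delta> a' \<odot> a + a' \<odot> ?y)) = 0"
    using derivable[of a a'] by (simp add: map_e)
  have 2: "m *\<^sub>R (- (?y \<odot> a' + ?y \<odot> f + a \<odot> \<delta> a')) + n *\<^sub>R (- (\<delta> a' \<odot> a + a' \<odot> ?y + f \<odot> ?y)) = 0"
    using derivable[of a "a' + f"]
    by (simp add: map_e add A_closed mul_simps zero algebra_simps)
  have "m *\<^sub>R (?y \<odot> f) + n *\<^sub>R (f \<odot> ?y) =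
    (m *\<^sub>R (- (?y \<odot> a' + a \<odot> \<delta> a')) + n *\<^sub>R (- (\<delta> a' \<odot> a + a' \<odot> ?y)))
    - (m *\<^sub>R (- (?y \<odot> a' + ?y \<odot> f + a \<odot> \<delta> a')) + n *\<^sub>R (- (\<delta> a' \<odot> a + a' \<odot> ?y + f \<odot> ?y)))"
    by (simp add: algebra_simps)
  with 1 2 have 3: "m *\<^sub>R (?y \<odot> f) + n *\<^sub>R (f \<odot> ?y) = 0"
    by simp
  have "?y \<odot> (e + f) = ?y" by (rule unit_right)
  then have "f \<odot> ?y = f \<odot> (?y \<odot> e) + f \<odot> (?y \<odot> f)"
    by (metis mul_simps(2))
  moreover have "f \<odot> (?y \<odot> e) = 0"
    using lower_zero[OF yA] by (simp add: assoc)
  ultimately have v: "f \<odot> (?y \<odot> f) = f \<odot> ?y"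
    by simp
  have "f \<odot> (m *\<^sub>R (?y \<odot> f) + n *\<^sub>R (f \<odot> ?y)) = 0"
    by (simp add: 3 mul_simps)
  then have "(m + n) *\<^sub>R (f \<odot> ?y) = 0"
    by (simp add: mul_simps v scaleR_add_left) (simp add: ff flip: assoc)
  then have "f \<odot> ?y = 0" using mn by simp
  with 3 m have "?y \<odot> f = 0" by simp
  then show ?thesis by (rule corner_eeI[OF yA])
qed

lemma map_ee:
  assumes "a \<in> corner e e"
  shows "\<delta> a \<in> corner e e"
  using assms
proof (induction rule: unit_induct)
  case (unit b c)
  then show ?case by (rule map_ee_unit)
next
  case (plus b r)
  then show ?case
    by (simp add: add scale A_closed corner_closed cornerD(1))
qed

lemma map_ef_equation:
  assumes M: "M \<in> corner e f"
  shows "n *\<^sub>R (\<delta> M \<odot> e) = m *\<^sub>R (\<delta> M + M \<odot> \<delta> f - e \<odot> \<delta> M)"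
proof -
  note q = map_ff[OF f_corner]
  note [simp] = cornerD[OF M] cornerD[OF q]
  have MM: "M \<odot> M = 0" "f \<odot> M = 0" "M \<odot> e = 0" "\<delta> f \<odot> M = 0" "\<delta> f \<odot> e = 0" "e \<odot> \<delta> f = 0"
    using corner_mul_zero[OF M M fe] corner_mul_zero[OF q M fe] f_mul_corner_e[OF M] corner_f_mul_e[OF M]
      corner_f_mul_e[OF q] e_mul_corner_f[OF q] by auto
  \<comment> \<open>The product of \<open>e + s M\<close> and \<open>e + f - s M\<close> is \<open>e\<close> for every scalar \<open>s\<close>; the cases
    \<open>s = \<plusminus>1\<close> isolate the part of the identity that is linear in \<open>M\<close>.\<close>
  let ?E = "\<lambda>s. m *\<^sub>R (- (s *\<^sub>R \<delta> M \<odot> (e + f - s *\<^sub>R M) + (e + s *\<^sub>R M) \<odot> (\<delta> f - s *\<^sub>R \<delta> M)))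
     + n *\<^sub>R (s *\<^sub>R \<delta> M - ((\<delta> f - s *\<^sub>R \<delta> M) \<odot> (e + s *\<^sub>R M) + (e + f - s *\<^sub>R M) \<odot> (s *\<^sub>R \<delta> M)))"
  have *: "?E s = 0" for s
  proof -
    have "(e + s *\<^sub>R M) \<odot> (e + f - s *\<^sub>R M) = e" "(e + f - s *\<^sub>R M) \<odot> (e + s *\<^sub>R M) = e + s *\<^sub>R M"
      by (simp_all add: mul_simps MM ee ef fe ff)
    then show ?thesis
      using derivable[of "e + s *\<^sub>R M" "e + f - s *\<^sub>R M"]
      by (simp add: add diff scale map_e A_closed)
  qed
  let ?X = "m *\<^sub>R (\<delta> M + M \<odot> \<delta> f - e \<odot> \<delta> M) - n *\<^sub>R (\<delta> M \<odot> e)"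
  have "\<delta> M \<odot> e + \<delta> M \<odot> f = \<delta> M" "e \<odot> \<delta> M + f \<odot> \<delta> M = \<delta> M"
    using unit_right[of "\<delta> M"] unit_left[of "\<delta> M"] by (simp_all add: mul_simps)
  then have r: "\<delta> M \<odot> f = \<delta> M - \<delta> M \<odot> e" "f \<odot> \<delta> M = \<delta> M - e \<odot> \<delta> M"
    by (simp_all add: algebra_simps)
  have "?X + ?X = ?E (- 1) - ?E 1"
    using MM by (simp add: mul_simps r) (simp add: algebra_simps)
  then have "2 *\<^sub>R ?X = 0"
    unfolding scaleR_2 by (simp only: *) simp
  then show ?thesis by simp
qed

text \<open>Multiplying \<open>map_ef_equation\<close> by \<open>e\<close> on the left gives
  \<open>n u = m M \<delta> f\<close> with \<open>u = \<delta> M e\<close>. Multiplying by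
  \<open>e\<close> on the right kills the right-hand side but fixes \<open>u\<close>, so both sides
  are zero, and the equation collapses to \<open>\<delta> M = e \<delta> M\<close>.\<close>

lemma map_ef:
  assumes M: "M \<in> corner e f"
  shows "\<delta> M \<in> corner e f"
proof -
  let ?u = "\<delta> M \<odot> e"
  have MA: "M \<in> A" using M by (rule cornerD)
  have "?u = (e + f) \<odot> ?u" by (simp only: unit_left)
  then have eu: "e \<odot> ?u = ?u"
    using lower_zero[OF closed[OF MA]] by (simp add: mul_simps assoc)
  have "e \<odot> (n *\<^sub>R ?u) = e \<odot> (m *\<^sub>R (\<delta> M + M \<odot> \<delta> f - e \<odot> \<delta> M))"
    by (simp only: map_ef_equation[OF M])
  also have "\<dots> = m *\<^sub>R (M \<odot> \<delta> f)"
    by (simp add: mul_simps ee cornerD(2)[OF M] flip: assoc)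
  finally have *: "n *\<^sub>R ?u = m *\<^sub>R (M \<odot> \<delta> f)"
    by (simp add: mul_simps eu)
  then have "(n *\<^sub>R ?u) \<odot> e = m *\<^sub>R (M \<odot> \<delta> f) \<odot> e"
    by (simp only:)
  also have "\<dots> = 0"
    using corner_f_mul_e[OF map_ff[OF f_corner]] by (simp add: mul_simps assoc)
  finally have u: "?u = 0"
    using n by (simp add: mul_simps assoc ee)
  with * m have q: "M \<odot> \<delta> f = 0" by simp
  have "\<delta> M = e \<odot> \<delta> M"
    using map_ef_equation[OF M] u q m by simp
  then have "f \<odot> \<delta> M = (f \<odot> e) \<odot> \<delta> M"
    by (metis assoc)
  then have "f \<odot> \<delta> M = 0"
    by (simp add: fe mul_simps)
  with u show "\<delta> M \<in> corner e f"
    by (intro corner_efI closed MA)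
qed

section \<open>The deviation from the Leibniz rule, up to sign the Hochschild coboundary of
  \<delta>\<close>

definition defect :: "'a \<Rightarrow> 'a \<Rightarrow> 'a"
  where "defect x y = \<delta> (x \<odot> y) - (\<delta> x \<odot> y + x \<odot> \<delta> y)"

lemma defect_add_left: "\<lbrakk>x \<in> A; y \<in> A; z \<in> A\<rbrakk> \<Longrightarrow> defect (x + y) z = defect x z + defect y z"
  and defect_add_right: "\<lbrakk>x \<in> A; y \<in> A; z \<in> A\<rbrakk> \<Longrightarrow> defect z (x + y) = defect z x + defect z y"
  and defect_diff_left: "\<lbrakk>x \<in> A; y \<in> A; z \<in> A\<rbrakk> \<Longrightarrow> defect (x - y) z = defect x z - defect y z"
  and defect_diff_right: "\<lbrakk>x \<in> A; y \<in> A; z \<in> A\<rbrakk> \<Longrightarrow> defect z (x - y) = defect z x - defect z y"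
  and defect_scale_left: "\<lbrakk>x \<in> A; z \<in> A\<rbrakk> \<Longrightarrow> defect (r *\<^sub>R x) z = r *\<^sub>R defect x z"
  by (simp_all add: defect_def mul_simps add diff scale A_closed algebra_simps)

lemmas defect_bilinear = defect_add_left defect_add_right defect_diff_left defect_diff_right
  defect_scale_left

lemma defect_derivable:
  "\<lbrakk>x \<in> A; y \<in> A; x \<odot> y = e\<rbrakk> \<Longrightarrow> m *\<^sub>R defect x y + n *\<^sub>R defect y x = 0"
  using derivable unfolding defect_def .

text \<open>In both sums the intermediate terms with \<open>\<delta> (x \<odot> y)\<close> or
  \<open>\<delta> (y \<odot> z)\<close> cancel; what remains is the deviation of \<delta> from the
  Leibniz rule for three factors.\<close>

lemma defect_cocycle:
  assumes "x \<in> A" "y \<in> A" "z \<in> A"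
  shows "defect (x \<odot> y) z + defect x y \<odot> z = defect x (y \<odot> z) + x \<odot> defect y z"
  by (simp add: defect_def mul_simps assoc algebra_simps)

lemma map_corner:
  assumes "(p, q) \<in> {(e, e), (e, f), (f, f)}" "x \<in> corner p q"
  shows "\<delta> x \<in> corner p q"
  using assms map_ee map_ef map_ff by auto

text \<open>As \<delta> preserves corners, all three products in the defect vanish;
  \<open>scale[of 0 0]\<close> contributes \<open>\<delta> 0 = 0\<close>.\<close>

lemma defect_eq_0_if_disjoint:
  assumes "x \<in> corner p q" "y \<in> corner q' r" "q \<odot> q' = 0"
    "(p, q) \<in> {(e, e), (e, f), (f, f)}" "(q', r) \<in> {(e, e), (e, f), (f, f)}"
  shows "defect x y = 0"
  using map_corner[OF assms(4,1)] map_corner[OF assms(5,2)] assms(1-3)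
    corner_mul_zero[of _ p q _ q' r] scale[of 0 0] A_closed(5)
  by (simp add: defect_def)

lemma defect_e_e: "defect e e = 0"
  by (simp add: defect_def ee map_e mul_simps)

text \<open>Since \<open>M \<odot> a = 0\<close>, adding \<open>M\<close> to the inverse
  \<open>a'\<close> keeps the product with \<open>a\<close> equal to \<open>e\<close>. Comparing the
  two admissible pairs leaves \<open>m D(M, a) + n D(a, M) = 0\<close>, whose first term is already
  zero.\<close>

lemma defect_ee_ef:
  assumes "a \<in> corner e e" "M \<in> corner e f"
  shows "defect a M = 0"
  using assms(1)
proof (induction rule: unit_induct)
  case (unit a a')
  note ip = inverse_pairD[OF unit]
  note M = assms(2)
  note [simp] = ip(3,4) cornerD(1)[OF ip(1)] cornerD(1)[OF ip(2)] cornerD(1)[OF M]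
  have z: "M \<odot> a = 0"
    by (rule corner_mul_zero[OF M ip(1) fe])
  have dz: "defect M a = 0"
    by (rule defect_eq_0_if_disjoint[OF M ip(1) fe]) auto
  have "m *\<^sub>R defect (a' + M) a + n *\<^sub>R defect a (a' + M) = 0"
    by (rule defect_derivable) (simp_all add: A_closed mul_simps z)
  moreover have "m *\<^sub>R defect a' a + n *\<^sub>R defect a a' = 0"
    by (rule defect_derivable) simp_all
  ultimately have "n *\<^sub>R defect a M = 0"
    by (simp add: defect_bilinear dz scaleR_add_right) (simp flip: add.assoc)
  then show ?case using n by simp
next
  case (plus b r)
  with assms(2) show ?case
    by (simp add: defect_bilinear A_closed cornerD(1))
qed

text \<open>The summand \<open>- M \<odot> X\<close> offsets the product of \<open>M\<close> and
  \<open>X\<close>, so that the pair multiplies to \<open>e\<close>. After bilinear expansion every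
  defect except \<open>D(M, X)\<close> is known to vanish.\<close>

lemma defect_ef_ff:
  assumes M: "M \<in> corner e f" and X: "X \<in> corner f f"
  shows "defect M X = 0"
proof -
  note MX = corner_mul[OF M X]
  note E = e_corner
  have mem: "M \<in> A" "X \<in> A" "M \<odot> X \<in> A"
    using M X MX by (simp_all add: cornerD(1))
  note zero = corner_f_mul_e[OF M] corner_f_mul_e[OF X] corner_f_mul_e[OF MX] e_mul_corner_f[OF X]
    cornerD(2)[OF M] cornerD(2)[OF MX]
    corner_mul_zero[OF M MX fe] corner_mul_zero[OF MX M fe] corner_mul_zero[OF X M fe]
  have D: "defect e X = 0" "defect M e = 0" "defect M (M \<odot> X) = 0" "defect (M \<odot> X) e = 0"
    "defect (M \<odot> X) M = 0" "defect X e = 0" "defect X M = 0"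
    using defect_eq_0_if_disjoint[OF E X ef] defect_eq_0_if_disjoint[OF M E fe]
      defect_eq_0_if_disjoint[OF M MX fe] defect_eq_0_if_disjoint[OF MX E fe]
      defect_eq_0_if_disjoint[OF MX M fe] defect_eq_0_if_disjoint[OF X E fe]
      defect_eq_0_if_disjoint[OF X M fe] by simp_all
  have "m *\<^sub>R defect (e + M) (e - M \<odot> X + X) + n *\<^sub>R defect (e - M \<odot> X + X) (e + M) = 0"
    by (rule defect_derivable) (simp_all add: A_closed mem mul_simps zero ee)
  then have "m *\<^sub>R defect M X = 0"
    by (simp add: defect_bilinear A_closed mem D defect_e_e defect_ee_ef[OF E M] defect_ee_ef[OF E MX])
  then show ?thesis using m by simp
qed

lemma defect_in_corner:
  assumes "x \<in> corner p p" "y \<in> corner p p" "p \<in> {e, f}"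
  shows "defect x y \<in> corner p p"
proof -
  have "\<delta> x \<in> corner p p" "\<delta> y \<in> corner p p" "\<delta> (x \<odot> y) \<in> corner p p"
    using assms corner_mul[OF assms(1,2)] map_corner by auto
  then show ?thesis
    unfolding defect_def using assms by (intro corner_closed corner_mul)
qed

lemma defect_ee_ee:
  assumes a: "a \<in> corner e e" and b: "b \<in> corner e e"
  shows "defect a b = 0"
proof (rule corner_ee_faithful)
  show "defect a b \<in> corner e e"
    by (rule defect_in_corner[OF a b]) simp
  show "defect a b \<odot> M = 0" if M: "M \<in> corner e f" for M
    \<comment> \<open>The other three terms of the cocycle identity have second argument in
      \<open>corner e f\<close>, where the defect is zero.\<close>
    using defect_cocycle[of a b M] defect_ee_ef[OF corner_mul[OF a b] M]
      defect_ee_ef[OF a corner_mul[OF b M]] defect_ee_ef[OF b M] a b M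
    by (simp add: cornerD(1) mul_simps)
qed

lemma defect_ff_ff:
  assumes X: "X \<in> corner f f" and Y: "Y \<in> corner f f"
  shows "defect X Y = 0"
proof (rule corner_ff_faithful)
  show "defect X Y \<in> corner f f"
    by (rule defect_in_corner[OF X Y]) simp
  show "M \<odot> defect X Y = 0" if M: "M \<in> corner e f" for M
    \<comment> \<open>Mirror image of the previous case: here the first argument of the three
      vanishing defects lies in \<open>corner e f\<close>.\<close>
    using defect_cocycle[of M X Y] defect_ef_ff[OF M corner_mul[OF X Y]]
      defect_ef_ff[OF corner_mul[OF M X] Y] defect_ef_ff[OF M X] X Y M
    by (simp add: cornerD(1) mul_simps)
qed

lemma defect_eq_0:
  assumes "x \<in> A" "y \<in> A"
  shows "defect x y = 0"
proof -
  obtain a M X where x: "a \<in> corner e e" "M \<in> corner e f" "X \<in> corner f f" "x = a + M + X"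
    using peirce_decomposition[OF assms(1)] .
  obtain b L Y where y: "b \<in> corner e e" "L \<in> corner e f" "Y \<in> corner f f" "y = b + L + Y"
    using peirce_decomposition[OF assms(2)] .
  have "defect a Y = 0" "defect M b = 0" "defect M L = 0" "defect X b = 0" "defect X L = 0"
    using defect_eq_0_if_disjoint[OF x(1) y(3) ef] defect_eq_0_if_disjoint[OF x(2) y(1) fe]
      defect_eq_0_if_disjoint[OF x(2) y(2) fe] defect_eq_0_if_disjoint[OF x(3) y(1) fe]
      defect_eq_0_if_disjoint[OF x(3) y(2) fe] by simp_all
  moreover have "defect a b = 0" "defect a L = 0" "defect M Y = 0" "defect X Y = 0"
    using x y defect_ee_ee defect_ee_ef defect_ef_ff defect_ff_ff by simp_all
  ultimately show ?thesis
    unfolding x y using x(1-3) y(1-3)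
    by (simp add: defect_bilinear A_closed cornerD(1))
qed

end

text \<open>Reduces to the normalised case by subtracting the inner derivation of
  \<open>t = \<delta> e\<close>. It sends \<open>e\<close> to \<open>e t - t e = t\<close>, because
  \<open>t\<close> lies in \<open>corner e f\<close>.\<close>

theorem (in derivable_map) derivation:
  assumes "x \<in> A" "y \<in> A"
  shows "\<delta> (x \<odot> y) = \<delta> x \<odot> y + x \<odot> \<delta> y"
proof -
  let ?t = "\<delta> e"
  let ?d = "\<lambda>x. \<delta> x - (x \<odot> ?t - ?t \<odot> x)"
  have t: "?t \<in> corner e f" by (rule map_e_corner)
  \<comment> \<open>The subtracted map satisfies the Leibniz rule, so hypothesis and conclusion
    carry over unchanged.\<close>
  have same_defect: "?d (x \<odot> y) - (?d x \<odot> y + x \<odot> ?d y) = \<delta> (x \<odot> y) - (\<delta> x \<odot> y + x \<odot> \<delta> y)" for x y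
    by (simp add: mul_simps assoc algebra_simps)
  interpret norm: normalised_derivable_map A mul e f ?d m n
  proof unfold_locales
    show "?d e = 0"
      using cornerD[OF t] corner_f_mul_e[OF t] by simp
    show "m *\<^sub>R (?d (x \<odot> y) - (?d x \<odot> y + x \<odot> ?d y)) + n *\<^sub>R (?d (y \<odot> x) - (?d y \<odot> x + y \<odot> ?d x)) = 0"
      if "x \<in> A" "y \<in> A" "x \<odot> y = e" for x y
      unfolding same_defect using that by (rule derivable)
  qed (simp_all add: A_closed closed add scale mul_simps algebra_simps m n mn)
  have "?d (x \<odot> y) - (?d x \<odot> y + x \<odot> ?d y) = 0"
    using norm.defect_eq_0[OF assms] unfolding norm.defect_def .
  then show ?thesis
    unfolding same_defect by simp
qed

section \<open>Nest algebras as triangular algebras\<close>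

instance chilbert_space \<subseteq> banach ..

text \<open>The triangle inequality belongs to the class axioms; expanding its square bounds the
  real part. Scaling \<open>x\<close> by the conjugate of the inner product turns this into a bound
  on the modulus.\<close>

lemma cinner_cmod_le: "cmod (cinner x y) \<le> norm x * norm y" for x y :: "'a::complex_inner"
proof -
  have Re_le: "Re (cinner x y) \<le> norm x * norm y" for x :: 'a
  proof -
    have "cinner (x + y) (x + y) = cinner x x + cinner y y + (cinner x y + cnj (cinner x y))"
      by (metis (no_types, lifting) cinner_add_left cinner_commute complex_cnj_add
          add.assoc add.commute add.left_commute)
    then have "complex_of_real ((norm (x + y))\<^sup>2) =
        complex_of_real ((norm x)\<^sup>2 + (norm y)\<^sup>2 + 2 * Re (cinner x y))"
      unfolding cinner_self complex_add_cnj by simp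
    then have "(norm (x + y))\<^sup>2 = (norm x)\<^sup>2 + (norm y)\<^sup>2 + 2 * Re (cinner x y)"
      unfolding of_real_eq_iff .
    moreover have "(norm (x + y))\<^sup>2 \<le> (norm x + norm y)\<^sup>2"
      by (intro power_mono norm_triangle_ineq norm_ge_zero)
    ultimately show ?thesis
      by (simp add: power2_sum)
  qed
  let ?z = "cinner x y"
  have "Re (cinner (cnj ?z *\<^sub>C x) y) = (cmod ?z)\<^sup>2"
    unfolding cmod_power2 by (simp add: cinner_scaleC_left power2_eq_square)
  then have "(cmod ?z)\<^sup>2 \<le> cmod ?z * (norm x * norm y)"
    using Re_le[of "cnj ?z *\<^sub>C x"] by (simp add: norm_scaleC mult.assoc)
  then show ?thesis
    by (cases "?z = 0") (simp_all add: power2_eq_square)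
qed

lift_definition rank_one :: "'h::complex_inner \<Rightarrow> 'h \<Rightarrow> 'h \<Rightarrow>\<^sub>L 'h"
  is "\<lambda>u v x. cinner x v *\<^sub>C u"
proof (rule bounded_linear_intro)
  fix u v x y :: 'h and r :: real
  show "cinner (x + y) v *\<^sub>C u = cinner x v *\<^sub>C u + cinner y v *\<^sub>C u"
    by (simp add: cinner_add_left scaleC_add_left)
  show "cinner (r *\<^sub>R x) v *\<^sub>C u = r *\<^sub>R (cinner x v *\<^sub>C u)"
    by (simp add: scaleR_scaleC cinner_scaleC_left scaleC_scaleC)
  show "norm (cinner x v *\<^sub>C u) \<le> norm x * (norm v * norm u)"
    using mult_right_mono[OF cinner_cmod_le[of x v] norm_ge_zero[of u]]
    by (simp add: norm_scaleC mult.assoc)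
qed

lemma clinear_op_rank_one: "clinear_op (rank_one u v)"
  by (simp add: clinear_op_def rank_one.rep_eq cinner_scaleC_left scaleC_scaleC)

lemma bilinear_blinfun_compose:
  "bilinear ((o\<^sub>L) :: ('a::real_normed_vector \<Rightarrow>\<^sub>L 'a) \<Rightarrow> ('a \<Rightarrow>\<^sub>L 'a) \<Rightarrow> ('a \<Rightarrow>\<^sub>L 'a))"
  by (auto simp: bilinear_def intro!: bounded_linear.linear
      bounded_bilinear.bounded_linear_left[OF bounded_bilinear_blinfun_compose]
      bounded_bilinear.bounded_linear_right[OF bounded_bilinear_blinfun_compose])

text \<open>Closedness of \<open>\<A>\<close> is what keeps the inverse inside: it is a limit of
  polynomials in \<open>a\<close>.\<close>

lemma neumann_inverse:
  fixes a :: "'a::banach \<Rightarrow>\<^sub>L 'a"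
  assumes "norm a < 1" and "closed \<A>" "id_blinfun \<in> \<A>"
    and add: "\<And>x y. \<lbrakk>x \<in> \<A>; y \<in> \<A>\<rbrakk> \<Longrightarrow> x + y \<in> \<A>"
    and mult: "\<And>x y. \<lbrakk>x \<in> \<A>; y \<in> \<A>\<rbrakk> \<Longrightarrow> x o\<^sub>L y \<in> \<A>"
    and "a \<in> \<A>"
  shows "\<exists>b\<in>\<A>. (id_blinfun - a) o\<^sub>L b = id_blinfun \<and> b o\<^sub>L (id_blinfun - a) = id_blinfun"
proof -
  define p where "p k = (((o\<^sub>L) a) ^^ k) id_blinfun" for k
  have p_0: "p 0 = id_blinfun" and p_Suc: "p (Suc k) = a o\<^sub>L p k" for k
    by (simp_all add: p_def)
  have p_Suc': "p (Suc k) = p k o\<^sub>L a" for k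
  proof (induction k)
    case (Suc k)
    then have "p (Suc (Suc k)) = a o\<^sub>L (p k o\<^sub>L a)"
      by (simp add: p_Suc)
    also have "\<dots> = p (Suc k) o\<^sub>L a"
      by (simp add: p_Suc blinfun_eqI)
    finally show ?case .
  qed (simp add: p_Suc p_0 blinfun_eqI)
  have p_in: "p k \<in> \<A>" for k
    by (induction k) (simp_all add: p_0 p_Suc assms)
  have norm_p: "norm (p k) \<le> norm a ^ k" for k
  proof (induction k)
    case 0
    then show ?case by (simp add: p_0 norm_blinfun_id_le)
  next
    case (Suc k)
    have "norm (p (Suc k)) \<le> norm a * norm (p k)"
      unfolding p_Suc by (rule norm_blinfun_compose)
    also have "\<dots> \<le> norm a * norm a ^ k"
      using Suc by (intro mult_left_mono) auto
    finally show ?case by simp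
  qed
  have "summable (\<lambda>k. norm a ^ k)"
    using assms(1) by (intro summable_geometric) simp
  then have "summable p"
    by (rule summable_comparison_test'[where N = 0]) (rule norm_p)
  then obtain b where b: "p sums b"
    by (auto simp: summable_def)
  have "b \<in> \<A>"
  \<comment> \<open>With \<open>sums_def_le\<close> the partial sums run over
    \<open>i \<le> k\<close>, so the induction starts at \<open>p 0\<close>, the identity.\<close>
  proof (rule Lim_in_closed_set[OF assms(2) _ _ b[unfolded sums_def_le]])
    have "(\<Sum>i\<le>k. p i) \<in> \<A>" for k
      by (induction k) (simp_all add: p_in add)
    then show "\<forall>\<^sub>F k in sequentially. (\<Sum>i\<le>k. p i) \<in> \<A>" by simp
  qed simp
  \<comment> \<open>The series without its first term is computed in three ways: by factoring out
    \<open>a\<close> on the left, on the right, and by subtracting \<open>p 0\<close>.\<close>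
  have "(\<lambda>k. p (Suc k)) sums (a o\<^sub>L b)"
    unfolding p_Suc
    by (rule bounded_linear.sums[OF bounded_bilinear.bounded_linear_right[OF bounded_bilinear_blinfun_compose] b])
  moreover have "(\<lambda>k. p (Suc k)) sums (b o\<^sub>L a)"
    unfolding p_Suc'
    by (rule bounded_linear.sums[OF bounded_bilinear.bounded_linear_left[OF bounded_bilinear_blinfun_compose] b])
  moreover have "(\<lambda>k. p (Suc k)) sums (b - id_blinfun)"
    using sums_Suc_iff[of p "b - id_blinfun"] b by (simp add: p_0)
  ultimately have "a o\<^sub>L b = b - id_blinfun" "b o\<^sub>L a = b - id_blinfun"
    by (metis sums_unique2)+
  then have "(id_blinfun - a) o\<^sub>L b = id_blinfun" "b o\<^sub>L (id_blinfun - a) = id_blinfun"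
    by (simp_all add: bounded_bilinear.diff_left[OF bounded_bilinear_blinfun_compose]
        bounded_bilinear.diff_right[OF bounded_bilinear_blinfun_compose]) (simp_all add: blinfun_eqI)
  with \<open>b \<in> \<A>\<close> show ?thesis by blast
qed

section \<open>Closure properties of nest algebras\<close>

lemma nest_algebraI:
  "\<lbrakk>clinear_op A; \<And>S x. \<lbrakk>S \<in> N; x \<in> S\<rbrakk> \<Longrightarrow> A x \<in> S\<rbrakk> \<Longrightarrow> A \<in> nest_algebra N"
  by (auto simp: nest_algebra_def)

lemma nest_algebraD:
  "A \<in> nest_algebra N \<Longrightarrow> clinear_op A"
  "\<lbrakk>A \<in> nest_algebra N; S \<in> N; x \<in> S\<rbrakk> \<Longrightarrow> A x \<in> S"
  by (auto simp: nest_algebra_def)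

lemma clinear_op_apply: "clinear_op A \<Longrightarrow> A (c *\<^sub>C x) = c *\<^sub>C A x"
  by (simp add: clinear_op_def)

lemma clinear_op_closed:
  "clinear_op id_blinfun" "clinear_op 0"
  "\<lbrakk>clinear_op A; clinear_op B\<rbrakk> \<Longrightarrow> clinear_op (A + B)"
  "\<lbrakk>clinear_op A; clinear_op B\<rbrakk> \<Longrightarrow> clinear_op (A - B)"
  "\<lbrakk>clinear_op A; clinear_op B\<rbrakk> \<Longrightarrow> clinear_op (A o\<^sub>L B)"
  "clinear_op A \<Longrightarrow> clinear_op (r *\<^sub>R A)"
  by (simp_all add: clinear_op_def blinfun.bilinear_simps scaleC_add_right
      complex_vector.scale_right_diff_distrib)
    (simp_all add: scaleR_scaleC scaleC_scaleC mult.commute)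

lemma clinear_op_limit:
  assumes "\<And>k. clinear_op (F k)" "F \<longlonglongrightarrow> A"
  shows "clinear_op A"
  unfolding clinear_op_def
proof (intro allI)
  fix c x
  have lim: "(\<lambda>k. F k y) \<longlonglongrightarrow> A y" for y
    by (intro tendsto_intros assms(2))
  have "(\<lambda>k. c *\<^sub>C F k x) \<longlonglongrightarrow> c *\<^sub>C A x"
    by (rule bounded_linear.tendsto[OF bounded_linear_scaleC lim])
  then have "(\<lambda>k. F k (c *\<^sub>C x)) \<longlonglongrightarrow> c *\<^sub>C A x"
    using assms(1) by (simp add: clinear_op_apply)
  then show "A (c *\<^sub>C x) = c *\<^sub>C A x"
    using lim LIMSEQ_unique by blast
qed

lemma csubspace_closed:
  assumes "csubspace S"
  shows "0 \<in> S" "\<lbrakk>x \<in> S; y \<in> S\<rbrakk> \<Longrightarrow> x + y \<in> S" "x \<in> S \<Longrightarrow> c *\<^sub>C x \<in> S"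
    "\<lbrakk>x \<in> S; y \<in> S\<rbrakk> \<Longrightarrow> x - y \<in> S" "x \<in> S \<Longrightarrow> r *\<^sub>R x \<in> S"
  using assms complex_vector.subspace_diff[OF assms]
  by (auto simp: complex_vector.subspace_def scaleR_scaleC)

context
  fixes N :: "'h::chilbert_space set set"
  assumes N: "nest N"
begin

lemma nest_csubspace: "S \<in> N \<Longrightarrow> csubspace S"
  and nest_closed: "S \<in> N \<Longrightarrow> closed S"
  using N by (auto simp: nest_def)

lemma nest_algebra_closed:
  "id_blinfun \<in> nest_algebra N" "0 \<in> nest_algebra N"
  "\<lbrakk>A \<in> nest_algebra N; B \<in> nest_algebra N\<rbrakk> \<Longrightarrow> A + B \<in> nest_algebra N"
  "\<lbrakk>A \<in> nest_algebra N; B \<in> nest_algebra N\<rbrakk> \<Longrightarrow> A - B \<in> nest_algebra N"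
  "\<lbrakk>A \<in> nest_algebra N; B \<in> nest_algebra N\<rbrakk> \<Longrightarrow> A o\<^sub>L B \<in> nest_algebra N"
  "A \<in> nest_algebra N \<Longrightarrow> r *\<^sub>R A \<in> nest_algebra N"
  by (simp_all add: nest_algebra_def image_subset_iff clinear_op_closed blinfun.bilinear_simps
      csubspace_closed[OF nest_csubspace])

lemma closed_nest_algebra: "closed (nest_algebra N)"
  unfolding closed_sequential_limits
proof (intro allI impI)
  fix F A
  assume F: "(\<forall>k. F k \<in> nest_algebra N) \<and> F \<longlonglongrightarrow> A"
  then have F_in: "F k \<in> nest_algebra N" and lim: "F \<longlonglongrightarrow> A" for k by simp_all
  show "A \<in> nest_algebra N"
  proof (rule nest_algebraI)
    show "clinear_op A"
      by (rule clinear_op_limit[OF nest_algebraD(1)[OF F_in] lim])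
    fix S x
    assume S: "S \<in> N" "x \<in> S"
    have "(\<lambda>k. F k x) \<longlonglongrightarrow> A x"
      by (intro tendsto_intros lim)
    then show "A x \<in> S"
      by (rule closed_sequentially[OF nest_closed[OF S(1)], rotated])
        (rule nest_algebraD(2)[OF F_in S])
  qed
qed

section \<open>Projections onto members of the nest\<close>

context
  fixes P :: "'h \<Rightarrow>\<^sub>L 'h" and S
  assumes S: "S \<in> N" and P: "orthogonal_projection_onto P S"
begin

lemma projection_in: "P x \<in> S"
  and projection_clinear: "clinear_op P"
  using P by (auto simp: orthogonal_projection_onto_def)

text \<open>The difference \<open>x - P x\<close> lies in \<open>S\<close> and is orthogonal to
  \<open>S\<close>, hence to itself.\<close>

lemma projection_fixes:
  assumes "x \<in> S"
  shows "P x = x"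
proof -
  have "x - P x \<in> S"
    using assms projection_in S by (intro csubspace_closed[OF nest_csubspace])
  then have "cinner (x - P x) (x - P x) = 0"
    using P by (auto simp: orthogonal_projection_onto_def)
  then show ?thesis
    by (simp add: cinner_self)
qed

lemma projection_idem: "P (P x) = P x"
  by (rule projection_fixes[OF projection_in])

lemma nest_trichotomy: "T \<in> N \<Longrightarrow> T \<subseteq> S \<or> S \<subseteq> T"
  using N S by (auto simp: nest_def)

lemma projection_in_nest_algebra: "P \<in> nest_algebra N"
proof (rule nest_algebraI[OF projection_clinear])
  fix T x
  assume T: "T \<in> N" "x \<in> T"
  then show "P x \<in> T"
    using nest_trichotomy[of T] projection_fixes projection_in by (metis subsetD)
qed

text \<open>A member of the nest inside \<open>S\<close> is annihilated by
  \<open>id_blinfun - P\<close>; any other contains \<open>S\<close> and so the whole range.\<close>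

lemma upper_corner_in_nest_algebra:
  assumes "clinear_op B"
  shows "P o\<^sub>L B o\<^sub>L (id_blinfun - P) \<in> nest_algebra N"
proof (rule nest_algebraI)
  show "clinear_op (P o\<^sub>L B o\<^sub>L (id_blinfun - P))"
    by (intro clinear_op_closed assms projection_clinear)
  fix T x
  assume T: "T \<in> N" "x \<in> T"
  from nest_trichotomy[OF T(1)] show "(P o\<^sub>L B o\<^sub>L (id_blinfun - P)) x \<in> T"
  proof
    assume "T \<subseteq> S"
    then show ?thesis
      using T projection_fixes[of x] csubspace_closed(1)[OF nest_csubspace[OF T(1)]]
      by (auto simp: blinfun.bilinear_simps)
  qed (use projection_in in auto)
qed

lemma projection_unit_plus_scalar:
  assumes A: "A \<in> nest_algebra N" and PAP: "P o\<^sub>L A o\<^sub>L P = A"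
  shows "\<exists>r. \<exists>B\<in>nest_algebra N. \<exists>C\<in>nest_algebra N. P o\<^sub>L B o\<^sub>L P = B \<and> P o\<^sub>L C o\<^sub>L P = C \<and>
    B o\<^sub>L C = P \<and> C o\<^sub>L B = P \<and> A = B + r *\<^sub>R P"
proof -
  \<comment> \<open>The extra 1 makes \<open>r\<close> positive even for \<open>A = 0\<close> and
    forces \<open>norm K < 1\<close>.\<close>
  define r where "r = norm A + 1"
  have r: "r > 0" by (simp add: r_def add_nonneg_pos)
  define K where "K = (1 / r) *\<^sub>R A"
  have "norm K < 1"
    using r by (simp add: K_def r_def)
  moreover have "K \<in> nest_algebra N"
    unfolding K_def by (intro nest_algebra_closed A)
  ultimately obtain R where R: "R \<in> nest_algebra N"
    "(id_blinfun - K) o\<^sub>L R = id_blinfun" "R o\<^sub>L (id_blinfun - K) = id_blinfun"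
    using neumann_inverse[of K "nest_algebra N"] closed_nest_algebra nest_algebra_closed by blast
  have PAP_apply: "P (A (P x)) = A x" for x
    using arg_cong[OF PAP, of "\<lambda>T. T x"] by simp
  have A_apply: "P (A x) = A x" "A (P x) = A x" for x
    by (metis PAP_apply projection_idem)+
  have A_eq: "A x = r *\<^sub>R K x" for x
    using r by (simp add: K_def blinfun.bilinear_simps)
  have K_apply: "P (K x) = K x" "K (P x) = K x" for x
    using A_apply[of x] by (simp_all add: K_def blinfun.bilinear_simps)
  have R1: "R x - K (R x) = x" and R2: "R x - R (K x) = x" for x
    using arg_cong[OF R(2), of "\<lambda>T. T x"] arg_cong[OF R(3), of "\<lambda>T. T x"]
    by (simp_all add: blinfun.bilinear_simps)
  have R3: "R (P x) - K (R (P x)) = P x" for x by (rule R1)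
  \<comment> \<open>\<open>R P = P + K R P\<close>, and \<open>P\<close> fixes both terms on the
    right.\<close>
  have PRP: "P (R (P x)) = R (P x)" for x
  proof -
    have "P (R (P x)) - K (R (P x)) = P (R (P x) - K (R (P x)))"
      by (simp only: blinfun.diff_right K_apply)
    also have "\<dots> = R (P x) - K (R (P x))"
      by (simp only: R3 projection_idem)
    finally
    show ?thesis by simp
  qed
  \<comment> \<open>On the corner \<open>?B\<close> acts as \<open>- r (1 - K)\<close>, so its
    inverse there is the compression of \<open>R\<close> divided by \<open>- r\<close>.\<close>
  let ?B = "A - r *\<^sub>R P" and ?C = "(- 1 / r) *\<^sub>R (P o\<^sub>L R o\<^sub>L P)"
  have "?B \<in> nest_algebra N" "?C \<in> nest_algebra N"
    by (intro nest_algebra_closed A R projection_in_nest_algebra)+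
  moreover have "P o\<^sub>L ?B o\<^sub>L P = ?B" "P o\<^sub>L ?C o\<^sub>L P = ?C"
    by (simp_all add: blinfun_eqI blinfun.bilinear_simps A_apply projection_idem)
  moreover have "?B o\<^sub>L ?C = P"
  proof (rule blinfun_eqI)
    fix x
    have "(?B o\<^sub>L ?C) x = R (P x) - K (R (P x))"
      using r by (simp add: blinfun.bilinear_simps A_eq PRP projection_idem scaleR_diff_right)
    then show "(?B o\<^sub>L ?C) x = P x" by (simp only: R3)
  qed
  moreover have "?C o\<^sub>L ?B = P"
  proof (rule blinfun_eqI)
    fix x
    have "(?C o\<^sub>L ?B) x = P (R (P x) - R (K (P x)))"
      using r by (simp add: blinfun.bilinear_simps A_eq PRP K_apply projection_idem scaleR_diff_right)
    then show "(?C o\<^sub>L ?B) x = P x" by (simp only: R2 projection_idem)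
  qed
  moreover have "A = ?B + r *\<^sub>R P" by simp
  ultimately show ?thesis by blast
qed

lemma triangular_nest_algebra:
  assumes "P \<noteq> 0" "P \<noteq> id_blinfun"
  shows "triangular_algebra (nest_algebra N) (o\<^sub>L) P (id_blinfun - P)"
proof
  let ?Q = "id_blinfun - P"
  show "subspace (nest_algebra N)"
    by (intro subspaceI nest_algebra_closed)
  show "bilinear ((o\<^sub>L) :: ('h \<Rightarrow>\<^sub>L 'h) \<Rightarrow> ('h \<Rightarrow>\<^sub>L 'h) \<Rightarrow> ('h \<Rightarrow>\<^sub>L 'h))"
    by (rule bilinear_blinfun_compose)
  show "P \<in> nest_algebra N" "?Q \<in> nest_algebra N"
    by (intro nest_algebra_closed projection_in_nest_algebra)+
  show "?Q o\<^sub>L A o\<^sub>L P = 0" if "A \<in> nest_algebra N" for A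
    using projection_fixes nest_algebraD(2)[OF that S projection_in]
    by (simp add: blinfun_eqI blinfun.bilinear_simps)
  \<comment> \<open>A rank-one operator need not lie in the nest algebra, but its upper corner does;
    idempotence lets that corner serve as the test element.\<close>
  have corner: "P o\<^sub>L rank_one u v o\<^sub>L ?Q = P o\<^sub>L (P o\<^sub>L rank_one u v o\<^sub>L ?Q) o\<^sub>L ?Q" for u v
    by (simp add: blinfun_eqI blinfun.bilinear_simps projection_idem)
  show "A = 0" if "A \<in> nest_algebra N" "A o\<^sub>L P = A"
    and zero: "\<And>B. B \<in> nest_algebra N \<Longrightarrow> A o\<^sub>L (P o\<^sub>L B o\<^sub>L ?Q) = 0" for A
  proof (rule blinfun_eqI)
    fix u
    \<comment> \<open>The operator \<open>rank_one u (?Q h)\<close> maps \<open>?Q h\<close> to a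
      nonzero multiple of \<open>u\<close>, so the test operator yields \<open>A (P u) = 0\<close>,
      which is \<open>A u = 0\<close>.\<close>
    obtain h where "P h \<noteq> h"
      using assms(2) by (metis blinfun_eqI blinfun_apply_id_blinfun)
    then have h: "?Q h \<noteq> 0"
      by (simp add: blinfun.diff_left)
    have "A o\<^sub>L (P o\<^sub>L rank_one u (?Q h) o\<^sub>L ?Q) = 0"
      by (subst corner) (intro zero upper_corner_in_nest_algebra clinear_op_rank_one)
    then have "A (P (cinner (?Q h) (?Q h) *\<^sub>C u)) = 0"
      by (metis blinfun_apply_blinfun_compose rank_one.rep_eq zero_blinfun.rep_eq)
    then have "cinner (?Q h) (?Q h) *\<^sub>C A u = 0"
      using that(2) clinear_op_apply[OF nest_algebraD(1)[OF that(1)]]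
      by (metis blinfun_apply_blinfun_compose)
    then have "A u = 0"
      using h by (simp add: cinner_self del: blinfun_apply_id_blinfun)
    then show "A u = (0 :: 'h \<Rightarrow>\<^sub>L 'h) u" by simp
  qed
  show "B = 0" if "B \<in> nest_algebra N" "?Q o\<^sub>L B = B"
    and zero: "\<And>A. A \<in> nest_algebra N \<Longrightarrow> P o\<^sub>L A o\<^sub>L ?Q o\<^sub>L B = 0" for B
  proof (rule blinfun_eqI)
    fix x
    \<comment> \<open>Evaluating the test operator built from \<open>u\<close> and
      \<open>B x\<close> at \<open>B x\<close> gives the squared norm of \<open>B x\<close> times
      \<open>P u\<close>.\<close>
    obtain u where u: "P u \<noteq> 0"
      using assms(1) by (metis blinfun_eqI zero_blinfun.rep_eq)
    have "P o\<^sub>L rank_one u (B x) o\<^sub>L ?Q o\<^sub>L B = 0"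
      by (subst corner) (intro zero upper_corner_in_nest_algebra clinear_op_rank_one)
    then have "P (cinner (?Q (B x)) (B x) *\<^sub>C u) = 0"
      by (metis blinfun_apply_blinfun_compose rank_one.rep_eq zero_blinfun.rep_eq)
    then have "cinner (B x) (B x) *\<^sub>C P u = 0"
      using that(2) clinear_op_apply[OF projection_clinear]
      by (metis blinfun_apply_blinfun_compose)
    then have "B x = 0"
      using u by (simp add: cinner_self)
    then show "B x = (0 :: 'h \<Rightarrow>\<^sub>L 'h) x" by simp
  qed
  show "\<exists>r. \<exists>B\<in>nest_algebra N. \<exists>C\<in>nest_algebra N. P o\<^sub>L B o\<^sub>L P = B \<and> P o\<^sub>L C o\<^sub>L P = C \<and>
    B o\<^sub>L C = P \<and> C o\<^sub>L B = P \<and> A = B + r *\<^sub>R P" if "A \<in> nest_algebra N" "P o\<^sub>L A o\<^sub>L P = A" for A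
    using that by (rule projection_unit_plus_scalar)
qed (simp_all add: nest_algebra_closed blinfun_eqI blinfun.bilinear_simps projection_idem)

end

end

theorem corollary3p6:
  fixes m n :: int
    and N :: "'h::chilbert_space set set"
    and P :: "'h \<Rightarrow>\<^sub>L 'h"
    and \<delta> :: "('h \<Rightarrow>\<^sub>L 'h) \<Rightarrow> ('h \<Rightarrow>\<^sub>L 'h)"
  assumes "m \<noteq> 0" and "n \<noteq> 0" and "m + n \<noteq> 0"
    and "separable_space (euclidean :: 'h topology)"
    and "nontrivial_nest N"
    and "P \<in> nest_projections N" and "P \<noteq> 0" and "P \<noteq> id_blinfun"
    and "derivable_at (nest_algebra N) m n P \<delta>"
  shows "derivation_on (nest_algebra N) \<delta>"
proof -
  have N: "nest N"
    using assms(5) by (simp add: nontrivial_nest_def)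
  obtain S where S: "S \<in> N" "orthogonal_projection_onto P S"
    using assms(6) by (auto simp: nest_projections_def)
  have linear: "linear_map_on (nest_algebra N) \<delta>"
    and derivable: "\<And>A B. \<lbrakk>A \<in> nest_algebra N; B \<in> nest_algebra N; A o\<^sub>L B = P\<rbrakk> \<Longrightarrow>
      of_int m *\<^sub>R \<delta> (A o\<^sub>L B) + of_int n *\<^sub>R \<delta> (B o\<^sub>L A) =
        of_int m *\<^sub>R (\<delta> A o\<^sub>L B) + of_int m *\<^sub>R (A o\<^sub>L \<delta> B)
        + of_int n *\<^sub>R (\<delta> B o\<^sub>L A) + of_int n *\<^sub>R (B o\<^sub>L \<delta> A)"
    using assms(9) by (auto simp: derivable_at_def)
  interpret triangular_algebra "nest_algebra N" "(o\<^sub>L)" P "id_blinfun - P"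
    by (rule triangular_nest_algebra[OF N S assms(7,8)])
  interpret derivable_map "nest_algebra N" "(o\<^sub>L)" P "id_blinfun - P" \<delta> "of_int m" "of_int n"
  proof
    show "of_int m *\<^sub>R (\<delta> (A o\<^sub>L B) - ((\<delta> A o\<^sub>L B) + (A o\<^sub>L \<delta> B)))
        + of_int n *\<^sub>R (\<delta> (B o\<^sub>L A) - ((\<delta> B o\<^sub>L A) + (B o\<^sub>L \<delta> A))) = 0"
      if "A \<in> nest_algebra N" "B \<in> nest_algebra N" "A o\<^sub>L B = P" for A B
      using derivable[OF that] by (simp add: algebra_simps)
    show "real_of_int m + real_of_int n \<noteq> 0"
      using assms(3) by (metis of_int_0_eq_iff of_int_add)
  \<comment> \<open>Real homogeneity comes from complex homogeneity through
    \<open>scaleR_scaleC\<close>.\<close>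
  qed (use linear assms(1,2) in \<open>auto simp: linear_map_on_def scaleR_scaleC\<close>)
  show ?thesis
    using linear derivation by (simp add: derivation_on_def)
qed

end
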